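(* Let $(A^\bullet,m,d,c)$ be a curved dg-algebra over a field $k$ of characteristic $0$, and let $L_c,R_c:A^\bullet\to A^\bullet$ be left and right multiplication by $c$, $L_c(a)=ca$, $R_c(a)=ac$. Assume $L_c^n=0$ and $R_c^n=0$ for some integer $n\ge 1$. Then $(\operatorname{ad}_c)^{2n-1}=0$. In particular, $d^{4n-2}=0$ and $(A^\bullet,d)$ is a $(4n-2)$-complex.
   Context: A curved dg-algebra $(A^\bullet,m,d,c)$ over a field $k$ of characteristic $0$ consists of an associative unital $\mathbb{Z}$-graded $k$-algebra $A^\bullet=\bigoplus_{i\in\mathbb{Z}}A^i$ with product $m$ and with every $A^i$ a finite-dimensional $k$-vector space; a $k$-linear map $d:A^\bullet\to A^\bullet$ of degree $1$ satisfying the graded Leibniz rule $d(xy)=d(x)y+(-1)^{|x|}x\,d(y)$ for homogeneous $x$; and an element $c\in A^2$ (the curvature) with $d(c)=0$ and $d^2=\operatorname{ad}_c$. Here $\operatorname{ad}_x=[x,-]$ for homogeneous $x$, where $[x,y]=xy-(-1)^{|x||y|}yx$ is the graded commutator. An $N$-complex is a graded module $(C^\bullet,d)$ with $d$ of degree $1$ and $d^N=0$. *)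

theory Defs
  imports Complex_Main
begin

text \<open>
  A graded module is an internal direct sum \<open>\<Oplus>\<^sub>i M i\<close> inside the type \<open>'m\<close>: every element is
  in exactly one way a sum of finitely many nonzero homogeneous components.
  Over a field, \<^locale>\<open>module\<close> coincides with \<^locale>\<open>vector_space\<close> (\<open>module_iff_vector_space\<close>).
\<close>

locale graded_module = module scale
  for scale :: "'r::comm_ring_1 \<Rightarrow> 'm::ab_group_add \<Rightarrow> 'm" (infixr \<open>*s\<close> 75) +
  fixes M :: "int \<Rightarrow> 'm set"
  assumes subspace_degree: "subspace (M i)"
    and decomposition:
      "\<exists>!f. (\<forall>i. f i \<in> M i) \<and> finite {i. f i \<noteq> 0} \<and> x = (\<Sum>i | f i \<noteq> 0. f i)"
begin

definition component :: "'m \<Rightarrow> int \<Rightarrow> 'm" where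
  "component x = (THE f. (\<forall>i. f i \<in> M i) \<and> finite {i. f i \<noteq> 0} \<and> x = (\<Sum>i | f i \<noteq> 0. f i))"

lemma component_homogeneous:
  assumes "x \<in> M i"
  shows "component x = (\<lambda>j. if j = i then x else 0)"
  unfolding component_def
proof (rule the1_equality[OF decomposition])
  have zero: "0 \<in> M j" for j
    using subspace_degree by (rule subspace_0)
  have "{j. (if j = i then x else 0) \<noteq> 0} = (if x = 0 then {} else {i})"
    by auto
  then show "(\<forall>j. (if j = i then x else 0) \<in> M j) \<and> finite {j. (if j = i then x else 0) \<noteq> 0} \<and>
      x = (\<Sum>j | (if j = i then x else 0) \<noteq> 0. if j = i then x else 0)"
    using assms zero by auto
qed

end

locale N_complex = graded_module scale C
  for scale :: "'r::comm_ring_1 \<Rightarrow> 'm::ab_group_add \<Rightarrow> 'm" and C :: "int \<Rightarrow> 'm set" +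
  fixes d :: "'m \<Rightarrow> 'm" and N :: nat
  assumes linear_d: "module_hom scale scale d"
    and degree_d: "x \<in> C i \<Longrightarrow> d x \<in> C (i + 1)"
    and nilpotent_d: "d ^^ N = (\<lambda>_. 0)"

text \<open>
  The sort \<open>{ring, monoid_mult}\<close> is used in place of \<^class>\<open>ring_1\<close> because the latter
  excludes the zero algebra.
\<close>

locale graded_algebra = graded_module scale A
  for scale :: "'k::field \<Rightarrow> 'a::{ring, monoid_mult} \<Rightarrow> 'a" (infixr \<open>*s\<close> 75)
    and A :: "int \<Rightarrow> 'a set" +
  assumes scale_mult_left: "(r *s x) * y = r *s (x * y)"
    and scale_mult_right: "x * (r *s y) = r *s (x * y)"
    and one_degree: "1 \<in> A 0"
    and mult_degree: "x \<in> A i \<Longrightarrow> y \<in> A j \<Longrightarrow> x * y \<in> A (i + j)"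
begin

text \<open>
  The graded commutator, extended biadditively from homogeneous elements to all of \<open>'a\<close>;
  \<open>graded_commutator_homogeneous\<close> gives the usual formula.
\<close>

definition graded_commutator :: "'a \<Rightarrow> 'a \<Rightarrow> 'a" where
  "graded_commutator x y =
    (\<Sum>i | component x i \<noteq> 0. \<Sum>j | component y j \<noteq> 0.
      component x i * component y j - ((-1) powi (i * j)) *s (component y j * component x i))"

definition ad :: "'a \<Rightarrow> 'a \<Rightarrow> 'a" where
  "ad x = (\<lambda>y. graded_commutator x y)"

lemma graded_commutator_homogeneous:
  assumes "x \<in> A i" "y \<in> A j"
  shows "graded_commutator x y = x * y - ((-1) powi (i * j)) *s (y * x)"
proof -
  have supp: "{l. (if l = k then z else 0) \<noteq> 0} = (if z = 0 then {} else {k})" for k :: int and z :: 'a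
    by auto
  show ?thesis
    unfolding graded_commutator_def component_homogeneous[OF assms(1)]
      component_homogeneous[OF assms(2)] supp
    by auto
qed

end

locale curved_dg_algebra = graded_algebra scale A
  for scale :: "'k::field_char_0 \<Rightarrow> 'a::{ring, monoid_mult} \<Rightarrow> 'a" (infixr \<open>*s\<close> 75)
    and A :: "int \<Rightarrow> 'a set" +
  fixes d :: "'a \<Rightarrow> 'a" and c :: 'a
  assumes finite_dimensional: "\<exists>B. finite B \<and> A i = span B"
    and linear_d: "module_hom scale scale d"
    and degree_d: "x \<in> A i \<Longrightarrow> d x \<in> A (i + 1)"
    and Leibniz: "x \<in> A i \<Longrightarrow> d (x * y) = d x * y + ((-1) powi i) *s (x * d y)"
    and curvature_degree: "c \<in> A 2"
    and d_curvature: "d c = 0"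
    and d_squared: "d ^^ 2 = ad c"

end

(* The grading sign of ad_c is trivial because c has even degree, so ad_c = L_c - R_c with
   commuting L_c and R_c; each monomial of degree 2n-1 in L_c and R_c contains L_c^n or R_c^n. *)
theory Submission imports Defs begin

text \<open>Since \<open>c\<close> has even degree, the sign in the graded commutator disappears and
  ad_c is the ordinary commutator L_c - R_c (\<open>ad_even\<close>). Instead of a binomial
  expansion of its power, \<open>mult_funpow_commutator_eq_0\<close> unfolds one commutator at a
  time, leaving terms c^p y c^q with p + q = 2n-1, which vanish because c^n = 0. The claim on
  \<open>d\<close> follows from d^2 = ad_c.\<close>

lemma sum_component:
  assumes "graded_module scale M"
  shows "(\<Sum>i | graded_module.component M x i \<noteq> 0. graded_module.component M x i) = x"
proof -
  interpret graded_module scale M by fact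
  from theI'[OF decomposition[of x]] show ?thesis
    unfolding component_def by metis
qed

lemma ad_even:
  fixes scale :: "'k::field \<Rightarrow> 'a::{ring, monoid_mult} \<Rightarrow> 'a"
  assumes "graded_algebra scale A" and "x \<in> A i" and "even i"
  shows "graded_algebra.ad scale A x = (\<lambda>y. x * y - y * x)"
proof
  interpret graded_algebra scale A by fact
  fix y
  have one: "((-1) powi (i * j)) = (1 :: 'k)" for j
    using \<open>even i\<close> by (simp add: power_int_minus_left)
  show "ad x y = x * y - y * x"
  \<comment> \<open>The support of the components of \<open>x\<close> is {i} only for nonzero
    \<open>x\<close>; it is empty for x = 0.\<close>
  proof (cases "x = 0")
    case True
    then show ?thesis
      unfolding ad_def graded_commutator_def component_homogeneous[OF \<open>x \<in> A i\<close>] by simp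
  next
    case False
    then have supp: "{l. (if l = i then x else 0) \<noteq> 0} = {i}"
      by auto
    have "ad x y = (\<Sum>j | component y j \<noteq> 0. x * component y j - component y j * x)"
      unfolding ad_def graded_commutator_def component_homogeneous[OF \<open>x \<in> A i\<close>] supp
      by (simp add: one)
    \<comment> \<open>Without signs the summand is additive in the component, so the components of
      \<open>y\<close> recombine to \<open>y\<close>.\<close>
    then show ?thesis
      using sum_component[OF graded_module_axioms, of y]
      by (simp add: sum_subtractf flip: sum_distrib_left sum_distrib_right)
  qed
qed

lemma funpow_mult_left: "((\<lambda>a. x * a) ^^ n) y = x ^ n * (y :: 'a::monoid_mult)"
  by (induction n) (simp_all add: mult.assoc)

text \<open>The outer powers make the induction on \<open>m\<close> work: unfolding a commutator
  moves one factor \<open>x\<close> to the left or the right power, so p + m + q is preserved. The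
  bound says p + m + q \<ge> 2n-1 without truncated subtraction.\<close>

lemma mult_funpow_commutator_eq_0:
  fixes x :: "'a::{ring, monoid_mult}"
  assumes "x ^ n = 0" and "2 * n \<le> p + m + q + 1"
  shows "x ^ p * ((\<lambda>y. x * y - y * x) ^^ m) y * x ^ q = 0"
  using assms(2)
proof (induction m arbitrary: p q)
  case 0
  have nil: "x ^ k = 0" if "n \<le> k" for k
    using that assms(1) power_add[of x n "k - n"] by simp
  \<comment> \<open>Pigeonhole: if both exponents were at most n-1, their sum would be at most
    2n-2.\<close>
  from 0 have "n \<le> p \<or> n \<le> q"
    by linarith
  then show ?case
    using nil by auto
next
  case (Suc m)
  let ?z = "((\<lambda>y. x * y - y * x) ^^ m) y"
  have "x ^ p * ((\<lambda>y. x * y - y * x) ^^ Suc m) y * x ^ q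
      = x ^ Suc p * ?z * x ^ q - x ^ p * ?z * x ^ Suc q"
    unfolding power_Suc2[of x p] power_Suc[of x q] by (simp add: algebra_simps)
  also have "\<dots> = 0"
    using Suc.IH[of "Suc p" q] Suc.IH[of p "Suc q"] Suc.prems by simp
  finally show ?case .
qed

theorem proposition3:
  fixes scale :: "'k::field_char_0 \<Rightarrow> 'a::{ring, monoid_mult} \<Rightarrow> 'a"
    and A :: "int \<Rightarrow> 'a set"
    and d :: "'a \<Rightarrow> 'a"
    and c :: 'a
    and n :: nat
  assumes "curved_dg_algebra scale A d c"
    and "n \<ge> 1"
    and "(\<lambda>a. c * a) ^^ n = (\<lambda>_. 0)"
    and "(\<lambda>a. a * c) ^^ n = (\<lambda>_. 0)"
  shows "graded_algebra.ad scale A c ^^ (2 * n - 1) = (\<lambda>_. 0) \<and>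
    d ^^ (4 * n - 2) = (\<lambda>_. 0) \<and>
    N_complex scale A d (4 * n - 2)"
proof -
  interpret curved_dg_algebra scale A d c by fact
  \<comment> \<open>Evaluate L_c^n at the unit.\<close>
  have "c ^ n = 0"
    using assms(3) funpow_mult_left[of n c 1] by simp
  then have ad_nil: "ad c ^^ (2 * n - 1) = (\<lambda>_. 0)"
    unfolding ad_even[OF graded_algebra_axioms curvature_degree even_numeral]
    using mult_funpow_commutator_eq_0[of c n 0 "2 * n - 1" 0] by fastforce
  \<comment> \<open>The exponent is 4n-2 = 2(2n-1), and each d^2 is one ad_c.\<close>
  have "d ^^ (4 * n - 2) = (d ^^ 2) ^^ (2 * n - 1)"
    by (simp add: funpow_mult diff_mult_distrib2)
  with ad_nil have d_nil: "d ^^ (4 * n - 2) = (\<lambda>_. 0)"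
    by (simp add: d_squared)
  have "N_complex scale A d (4 * n - 2)"
    by (intro N_complex.intro N_complex_axioms.intro graded_module_axioms linear_d degree_d d_nil)
  with ad_nil d_nil show ?thesis
    by blast
qed

end
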